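(* Let $f\colon\mathbb{R}^n\to[-\infty,+\infty]$ be a proper nearly convex function and let $D\subset\mathbb{R}^n$ be a nonempty nearly convex set such that $(\mathrm{ri}\,D)\cap\mathrm{ri}(\mathrm{dom}\,f)\neq\emptyset$. Then any local solution $\bar x$ of the problem $\min\{f(x)\mid x\in D\}$ with $f(\bar x)\in\mathbb{R}$ is a global solution. Thus, the set of local solutions of this problem at which $f$ takes a finite value coincides with the set of its global solutions.
   Context: A set $\Omega\subset\mathbb{R}^n$ is nearly convex if there is a convex set $C\subset\mathbb{R}^n$ with $C\subset\Omega\subset\bar C$, where the bar on a set denotes topological closure. For an arbitrary set $\Omega$, $\mathrm{ri}\,\Omega$ is the interior of $\Omega$ relative to its affine hull. For $f\colon\mathbb{R}^n\to[-\infty,+\infty]$: $\mathrm{dom}\,f=\{x\mid f(x)<+\infty\}$, $\mathrm{epi}\,f=\{(x,\lambda)\in\mathbb{R}^n\times\mathbb{R}\mid f(x)\le\lambda\}$; $f$ is proper if $\mathrm{dom}\,f\ne\emptyset$ and $f(x)>-\infty$ for all $x$; $f$ is nearly convex if $\mathrm{epi}\,f$ is a nearly convex set. A point $\bar x\in D$ is a global solution if $f(\bar x)\le f(x)$ for all $x\in D$, and a local solution if there is $\varepsilon>0$ with $f(\bar x)\le f(x)$ for all $x\in D$ with $\|x-\bar x\|\le\varepsilon$. *)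

theory Defs
  imports "HOL-Analysis.Analysis"
begin

definition nearly_convex :: "'a::euclidean_space set \<Rightarrow> bool" where
  "nearly_convex S \<longleftrightarrow> (\<exists>C. convex C \<and> C \<subseteq> S \<and> S \<subseteq> closure C)"

definition effective_domain :: "('a \<Rightarrow> ereal) \<Rightarrow> 'a set" where
  "effective_domain f = {x. f x < \<infinity>}"

text \<open>The library's \<^const>\<open>epigraph\<close> covers only real-valued functions; here the function
  is extended-real-valued while the second component of a point stays real.\<close>

definition ereal_epigraph :: "('a \<Rightarrow> ereal) \<Rightarrow> ('a \<times> real) set" where
  "ereal_epigraph f = {(x, r). f x \<le> ereal r}"

definition proper_fun :: "('a \<Rightarrow> ereal) \<Rightarrow> bool" where
  "proper_fun f \<longleftrightarrow> effective_domain f \<noteq> {} \<and> (\<forall>x. f x > -\<infinity>)"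

definition nearly_convex_fun :: "('a::euclidean_space \<Rightarrow> ereal) \<Rightarrow> bool" where
  "nearly_convex_fun f \<longleftrightarrow> nearly_convex (ereal_epigraph f)"

definition global_solution :: "('a \<Rightarrow> ereal) \<Rightarrow> 'a set \<Rightarrow> 'a \<Rightarrow> bool" where
  "global_solution f D x \<longleftrightarrow> x \<in> D \<and> (\<forall>y\<in>D. f x \<le> f y)"

definition local_solution :: "('a::real_normed_vector \<Rightarrow> ereal) \<Rightarrow> 'a set \<Rightarrow> 'a \<Rightarrow> bool" where
  "local_solution f D x \<longleftrightarrow>
     x \<in> D \<and> (\<exists>e>0. \<forall>y\<in>D. norm (y - x) \<le> e \<longrightarrow> f x \<le> f y)"

end

theory Submission
  imports Defs
begin

text \<open>A nearly convex set has the same relative interior as the convex set that it contains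
  densely, so segments from a relative interior point to any point of the set stay, apart from the
  endpoint, in the relative interior. Applied to the domain and to the epigraph, this gives the
  classical argument: if \<open>f y < f x\<close>, move from \<open>y\<close> slightly towards a common
  relative interior point to reach some \<open>z\<close> with \<open>f z < f x\<close> and \<open>z\<close> in the relative interior of
  \<open>D\<close>; all points of the segment from \<open>z\<close> to \<open>x\<close> other than \<open>x\<close> then lie in \<open>D\<close>
  and have value below \<open>f x\<close>.\<close>

text \<open>All the sets involved have the affine hull of \<open>C\<close>, so
  \<open>rel_interior\<close> is monotone along the inclusions; the two outer relative interiors
  agree by convexity of \<open>C\<close>.\<close>

lemma rel_interior_between_convex_closure:
  fixes C S :: "'a::euclidean_space set"
  assumes "convex C" "C \<subseteq> S" "S \<subseteq> closure C"
  shows "rel_interior S = rel_interior C"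
proof -
  have aff: "affine hull S = affine hull C"
    using hull_mono[OF assms(2), of affine] hull_mono[OF assms(3), of affine] by simp
  have "rel_interior S \<subseteq> rel_interior (closure C)"
    using assms(3) aff by (intro subset_rel_interior) simp_all
  moreover have "rel_interior C \<subseteq> rel_interior S"
    using assms(2) aff by (intro subset_rel_interior) simp_all
  ultimately show ?thesis
    using convex_rel_interior_closure[OF assms(1)] by blast
qed

lemma nearly_convex_rel_interior_convex_comb:
  fixes S :: "'a::euclidean_space set"
  assumes "nearly_convex S" "a \<in> rel_interior S" "b \<in> S" "0 < t" "t \<le> 1"
  shows "(1 - t) *\<^sub>R b + t *\<^sub>R a \<in> rel_interior S"
proof -
  obtain C where C: "convex C" "C \<subseteq> S" "S \<subseteq> closure C"
    using assms(1) unfolding nearly_convex_def by blast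
  have "b - t *\<^sub>R (b - a) \<in> rel_interior C"
    using assms C rel_interior_between_convex_closure[OF C]
    by (intro rel_interior_closure_convex_shrink) auto
  then show ?thesis
    by (simp add: rel_interior_between_convex_closure[OF C] algebra_simps)
qed

text \<open>By continuity of \<open>h\<close>, the convex set \<open>h\<close>
  C\<open>is dense in\<close>h \<open>S\<close>, so the convex case carries over. With
  \<open>h = fst\<close> this lifts relative interior points of the domain to the epigraph.\<close>

lemma nearly_convex_rel_interior_linear_image:
  fixes h :: "'a::euclidean_space \<Rightarrow> 'b::euclidean_space"
  assumes "linear h" "nearly_convex S"
  shows "rel_interior (h ` S) = h ` rel_interior S"
proof -
  obtain C where C: "convex C" "C \<subseteq> S" "S \<subseteq> closure C"
    using assms(2) unfolding nearly_convex_def by blast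
  have "h ` S \<subseteq> closure (h ` C)"
    using C(3) closure_linear_image_subset[OF assms(1)] by blast
  then have "rel_interior (h ` S) = rel_interior (h ` C)"
    using C assms(1) by (intro rel_interior_between_convex_closure convex_linear_image image_mono)
  also have "\<dots> = h ` rel_interior C"
    using rel_interior_convex_linear_image[OF assms(1) C(1)] by simp
  finally show ?thesis
    by (simp add: rel_interior_between_convex_closure[OF C])
qed

lemma effective_domain_eq_fst_epigraph:
  "effective_domain f = fst ` ereal_epigraph f"
proof -
  have "\<exists>r. f x \<le> ereal r" if "f x < \<infinity>" for x
    using that by (cases "f x") auto
  then show ?thesis
    by (force simp: effective_domain_def ereal_epigraph_def)
qed

lemma local_solution_imp_le:
  fixes f :: "'a::euclidean_space \<Rightarrow> ereal"
  assumes "nearly_convex_fun f" "nearly_convex D"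
    and "a \<in> rel_interior D" "a \<in> rel_interior (effective_domain f)"
    and "local_solution f D x" "\<bar>f x\<bar> \<noteq> \<infinity>"
    and "y \<in> D"
  shows "f x \<le> f y"
proof (rule ccontr)
  let ?E = "ereal_epigraph f"
  assume "\<not> f x \<le> f y"
  moreover obtain c where c: "f x = ereal c"
    using assms(6) by auto
  ultimately have "f y < ereal c"
    by simp
  \<comment> \<open>Points of the epigraph have real heights, and the gap below \<open>c\<close>
    leaves room for a small move.\<close>
  then obtain b where "f y < ereal b" "ereal b < ereal c"
    using ereal_dense2 by metis
  then have b: "f y < ereal b" "b < c"
    by simp_all
  have E: "nearly_convex ?E"
    using assms(1) by (simp add: nearly_convex_fun_def)
  obtain r where r: "(a, r) \<in> rel_interior ?E"
    using assms(4) nearly_convex_rel_interior_linear_image[OF linear_fst E]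
    by (auto simp: effective_domain_eq_fst_epigraph)
  \<comment> \<open>Nothing bounds \<open>r\<close>, but the height tends to \<open>b < c\<close> as
    \<open>t\<close> decreases to 0.\<close>
  obtain t where t: "0 < t" "t \<le> 1" "(1 - t) * b + t * r < c"
  proof -
    have "((\<lambda>t. (1 - t) * b + t * r) \<longlongrightarrow> (1 - 0) * b + 0 * r) (at_right 0)"
      by (intro tendsto_intros)
    then have "\<forall>\<^sub>F t in at_right 0. (1 - t) * b + t * r < c"
      using b(2) by (intro order_tendstoD) auto
    moreover have "\<forall>\<^sub>F t in at_right 0. t \<in> {0<..<1::real}"
      by (rule eventually_at_right_real) simp
    ultimately have "\<forall>\<^sub>F t in at_right 0. t \<in> {0<..<1} \<and> (1 - t) * b + t * r < c"
      by eventually_elim simp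
    then have "\<exists>t. t \<in> {0<..<1} \<and> (1 - t) * b + t * r < c"
      by (rule eventually_happens'[OF trivial_limit_at_right_real])
    then show ?thesis
      using that by auto
  qed
  define z where "z = (1 - t) *\<^sub>R y + t *\<^sub>R a"
  define s where "s = (1 - t) * b + t * r"
  have zD: "z \<in> rel_interior D"
    using nearly_convex_rel_interior_convex_comb[OF assms(2,3,7) t(1,2)] by (simp add: z_def)
  have "(y, b) \<in> ?E"
    using b by (simp add: ereal_epigraph_def)
  from nearly_convex_rel_interior_convex_comb[OF E r this t(1,2)]
  have zE: "(z, s) \<in> rel_interior ?E"
    by (simp add: z_def s_def)
  obtain e where e: "e > 0" "\<And>w. w \<in> D \<Longrightarrow> norm (w - x) \<le> e \<Longrightarrow> f x \<le> f w" and "x \<in> D"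
    using assms(5) unfolding local_solution_def by blast
  \<comment> \<open>The summand 1 keeps the denominator positive even if
    \<open>z = x\<close>.\<close>
  define u where "u = min 1 (e / (norm (z - x) + 1))"
  have u: "0 < u" "u \<le> 1"
    using e(1) by (auto simp: u_def intro!: divide_pos_pos add_nonneg_pos)
  define w where "w = (1 - u) *\<^sub>R x + u *\<^sub>R z"
  \<comment> \<open>This is why \<open>y\<close> was replaced by \<open>z\<close>: the segment from
    \<open>y\<close> to \<open>x\<close> might leave \<open>D\<close>.\<close>
  have "w \<in> D"
    using nearly_convex_rel_interior_convex_comb[OF assms(2) zD \<open>x \<in> D\<close> u] rel_interior_subset
    by (auto simp: w_def)
  moreover have "norm (w - x) \<le> e"
  proof -
    have "w - x = u *\<^sub>R (z - x)"
      by (simp add: w_def algebra_simps)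
    then have "norm (w - x) \<le> u * (norm (z - x) + 1)"
      using u by simp
    also have "\<dots> \<le> e / (norm (z - x) + 1) * (norm (z - x) + 1)"
      by (intro mult_right_mono) (auto simp: u_def)
    also have "\<dots> = e"
      using norm_ge_zero[of "z - x"] by (simp add: add_nonneg_eq_0_iff)
    finally show ?thesis .
  qed
  ultimately have "f x \<le> f w"
    by (rule e(2))
  have "(x, c) \<in> ?E"
    by (simp add: ereal_epigraph_def c)
  from nearly_convex_rel_interior_convex_comb[OF E zE this u]
  have "(w, (1 - u) * c + u * s) \<in> ?E"
    using rel_interior_subset by (auto simp: w_def)
  \<comment> \<open>Local optimality bounds \<open>f w\<close> below by \<open>c\<close>, the
    epigraph bounds it above; as \<open>u > 0\<close>, this forces \<open>c \<le> s\<close>, against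
    the choice of \<open>t\<close>.\<close>
  then have "c \<le> (1 - u) * c + u * s"
    using \<open>f x \<le> f w\<close> c by (auto simp: ereal_epigraph_def dest: order_trans)
  then have "u * c \<le> u * s"
    by (simp add: algebra_simps)
  then show False
    using u t(3) by (simp add: s_def)
qed

theorem theorem3p2:
  fixes f :: "real ^ 'n \<Rightarrow> ereal" and D :: "(real ^ 'n) set"
  assumes "proper_fun f"
    and "nearly_convex_fun f"
    and "D \<noteq> {}"
    and "nearly_convex D"
    and "rel_interior D \<inter> rel_interior (effective_domain f) \<noteq> {}"
  shows "(\<forall>x. local_solution f D x \<and> \<bar>f x\<bar> \<noteq> \<infinity> \<longrightarrow> global_solution f D x)
       \<and> {x. local_solution f D x \<and> \<bar>f x\<bar> \<noteq> \<infinity>} = {x. global_solution f D x}"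
proof -
  obtain a where a: "a \<in> rel_interior D" "a \<in> rel_interior (effective_domain f)"
    using assms(5) by blast
  have global: "global_solution f D x" if "local_solution f D x" "\<bar>f x\<bar> \<noteq> \<infinity>" for x
    using local_solution_imp_le[OF assms(2,4) a that] that(1)
    by (auto simp: global_solution_def local_solution_def)
  have "local_solution f D x \<and> \<bar>f x\<bar> \<noteq> \<infinity>" if g: "global_solution f D x" for x
  proof
    show "local_solution f D x"
      using g by (auto simp: global_solution_def local_solution_def intro: exI[of _ 1])
    \<comment> \<open>The common point \<open>a\<close> is feasible, so its value bounds the minimum
      from above.\<close>
    have "a \<in> D" "f a < \<infinity>"
      using a rel_interior_subset by (auto simp: effective_domain_def)
    then have "f x < \<infinity>"
      using g by (auto simp: global_solution_def intro: le_less_trans)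
    moreover have "f x > -\<infinity>"
      using assms(1) by (simp add: proper_fun_def)
    ultimately show "\<bar>f x\<bar> \<noteq> \<infinity>"
      by auto
  qed
  with global have "local_solution f D x \<and> \<bar>f x\<bar> \<noteq> \<infinity> \<longleftrightarrow> global_solution f D x" for x
    by metis
  then show ?thesis
    by simp
qed

end
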